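(* Let $\mathcal{X}$ be an $N$-order tensor with all mode lengths equal to $I$ and with set of observable entries $\Omega$, and let the core tensor have all mode lengths equal to $J$. Then the time complexity of one iteration of the P-Tucker-Cache algorithm is $O(NIJ^3+N|\Omega|J^N)$.
   Context: Time is measured as the total number of elementary operations (summed over all threads); inverting a $J\times J$ matrix is counted as $O(J^3)$. Data: tensor $\mathcal{X}$ with observable index tuples $\Omega\subseteq\{1,\dots,I\}^N$, factor matrices $\mathbf{A}^{(n)}=(a^{(n)}_{ij})\in\mathbb{R}^{I\times J}$ ($n=1,\dots,N$), core tensor $\mathcal{G}\in\mathbb{R}^{J\times\cdots\times J}$ of order $N$, regularization parameter $\lambda>0$. $\Omega^{(n)}_{i_n}$ is the set of tuples in $\Omega$ with $n$th coordinate $i_n$. P-Tucker-Cache additionally maintains a cache table $Pres$ with one entry $Pres[\alpha][\beta]$ for each $\alpha\in\Omega$ and each $\beta\in\{1,\dots,J\}^N$. One iteration of P-Tucker-Cache: (0) Precompute $Pres[\alpha][\beta]=\mathcal{G}_\beta\prod_{k=1}^N a^{(k)}_{i_kj_k}$ for all $\alpha=(i_1,\dots,i_N)\in\Omega$ and $\beta=(j_1,\dots,j_N)$. (1) For each $n=1,\dots,N$: for each row $i_n=1,\dots,I$ and each $\alpha\in\Omega^{(n)}_{i_n}$, compute $\delta^{(n)}_\alpha\in\mathbb{R}^J$ by looping over all $\beta=(j_1,\dots,j_N)$ and adding $Pres[\alpha][\beta]/a^{(n)}_{i_nj_n}$ (one division, $O(1)$) to $\delta^{(n)}_\alpha(j_n)$;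 accumulate $\mathbf{B}^{(n)}_{i_n}\in\mathbb{R}^{J\times J}$, with entries $\sum_{\alpha\in\Omega^{(n)}_{i_n}}\delta^{(n)}_\alpha(j)\delta^{(n)}_\alpha(j')$, and $\mathbf{c}^{(n)}_{i_n:}\in\mathbb{R}^J$, with entries $\sum_{\alpha\in\Omega^{(n)}_{i_n}}\mathcal{X}_\alpha\delta^{(n)}_\alpha(j)$; invert $\mathbf{B}^{(n)}_{i_n}+\lambda\mathbf{I}_J$ and replace the $i_n$th row of $\mathbf{A}^{(n)}$ by $\mathbf{c}^{(n)}_{i_n:}[\mathbf{B}^{(n)}_{i_n}+\lambda\mathbf{I}_J]^{-1}$. After all rows of $\mathbf{A}^{(n)}$ are updated, update the cache by $Pres[\alpha][\beta]\leftarrow \bigl(Pres[\alpha][\beta]/(\text{old }a^{(n)}_{i_nj_n})\bigr)\cdot(\text{new }a^{(n)}_{i_nj_n})$ for all $\alpha,\beta$. (When the divisor $a^{(n)}_{i_nj_n}$ is $0$, the needed product is computed by direct multiplication instead.) (2) Compute the reconstruction error $\Bigl(\sum_{(i_1,\dots,i_N)\in\Omega}\bigl(\mathcal{X}_{(i_1,\dots,i_N)}-\sum_{(j_1,\dots,j_N)}\mathcal{G}_{(j_1,\dots,j_N)}\prod_{n=1}^N a^{(n)}_{i_nj_n}\bigr)^2\Bigr)^{1/2}$ directly from this formula.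
   Formalization: When a divisor is 0, the direct multiplication visits the modes cyclically after the current one and stops at the first zero factor; with full N−1 multiplications each time the bound fails (all factor entries 0, I=J=|Ω|=1 gives order N² against 2N). *)

theory Defs
  imports
    Complex_Main
    "HOL-Library.Landau_Symbols"
    "HOL-Library.Monad_Syntax"
    "Jordan_Normal_Form.Gauss_Jordan_Elimination"
begin

section \<open>Computations with an operation counter\<close>

datatype 'a timed = Timed (result: 'a) (steps: nat)

definition ret :: "'a \<Rightarrow> 'a timed" where
  "ret x = Timed x 0"

definition tbind :: "'a timed \<Rightarrow> ('a \<Rightarrow> 'b timed) \<Rightarrow> 'b timed" where
  "tbind m f = Timed (result (f (result m))) (steps m + steps (f (result m)))"

adhoc_overloading Monad_Syntax.bind == tbind

text \<open>
  Every arithmetic operation, zero test and table write, and every pass through a loop, is one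
  elementary operation. Reading a table entry is part of the operation that consumes it, and the
  pass counter covers stepping to the next loop index. The work of all threads is executed
  sequentially here, so the counter is the total over the threads.
\<close>

definition tick :: "'a \<Rightarrow> 'a timed" where
  "tick x = Timed x 1"

definition tadd :: "real \<Rightarrow> real \<Rightarrow> real timed" where
  "tadd x y = tick (x + y)"

definition tsub :: "real \<Rightarrow> real \<Rightarrow> real timed" where
  "tsub x y = tick (x - y)"

definition tmul :: "real \<Rightarrow> real \<Rightarrow> real timed" where
  "tmul x y = tick (x * y)"

definition tdiv :: "real \<Rightarrow> real \<Rightarrow> real timed" where
  "tdiv x y = tick (x / y)"

definition tsqrt :: "real \<Rightarrow> real timed" where
  "tsqrt x = tick (sqrt x)"

definition is_zero :: "real \<Rightarrow> bool timed" where
  "is_zero x = tick (x = 0)"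

definition put1 :: "('a \<Rightarrow> 'b) \<Rightarrow> 'a \<Rightarrow> 'b \<Rightarrow> ('a \<Rightarrow> 'b) timed" where
  "put1 f i y = tick (f(i := y))"

definition put2 :: "('a \<Rightarrow> 'b \<Rightarrow> 'c) \<Rightarrow> 'a \<Rightarrow> 'b \<Rightarrow> 'c \<Rightarrow> ('a \<Rightarrow> 'b \<Rightarrow> 'c) timed" where
  "put2 f i j y = tick (f(i := (f i)(j := y)))"

primrec for_each :: "'i list \<Rightarrow> ('i \<Rightarrow> 's \<Rightarrow> 's timed) \<Rightarrow> 's \<Rightarrow> 's timed" where
  "for_each [] body s = ret s"
| "for_each (x # xs) body s =
     do { s1 \<leftarrow> tick s; s2 \<leftarrow> body x s1; for_each xs body s2 }"


section \<open>Data\<close>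

text \<open>
  Modes, rows and columns are numbered from 0: the modes are \<open>0, ..., N - 1\<close>, and an index tuple
  is a list of length \<open>N\<close> whose \<open>n\<close>-th entry is the coordinate in mode \<open>n\<close>. The factor
  matrices are \<open>A n i j\<close> with mode \<open>n < N\<close>, row \<open>i < I\<close> and column \<open>j < J\<close>; tensors are functions
  of index tuples. Entries outside these ranges are never accessed.
\<close>

type_synonym tensor = "nat list \<Rightarrow> real"
type_synonym factors = "nat \<Rightarrow> nat \<Rightarrow> nat \<Rightarrow> real"
type_synonym cache = "nat list \<Rightarrow> nat list \<Rightarrow> real"

definition index_tuples :: "nat \<Rightarrow> nat \<Rightarrow> nat list set" where
  "index_tuples N d = {\<alpha>. length \<alpha> = N \<and> set \<alpha> \<subseteq> {..<d}}"

text \<open>The core tuples \<open>\<beta>\<close>, each exactly once, as a loop range.\<close>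

definition core_tuples :: "nat \<Rightarrow> nat \<Rightarrow> nat list list" where
  "core_tuples N J = List.n_lists N [0..<J]"

text \<open>
  The observed tuples are stored in a list, and each set of observed tuples with \<open>n\<close>-th
  coordinate \<open>i\<close> is available as a list as well; it is part of the sparse representation of the
  data and is not computed by the iteration.
\<close>

definition slice :: "nat list list \<Rightarrow> nat \<Rightarrow> nat \<Rightarrow> nat list list" where
  "slice obs n i = filter (\<lambda>\<alpha>. \<alpha> ! n = i) obs"


section \<open>One iteration\<close>

text \<open>The full product of \<open>G \<beta>\<close> with all \<open>N\<close> factor entries.\<close>

definition core_product :: "nat \<Rightarrow> tensor \<Rightarrow> factors \<Rightarrow> nat list \<Rightarrow> nat list \<Rightarrow> real timed" where
  "core_product N G A \<alpha> \<beta> = for_each [0..<N] (\<lambda>k p. tmul p (A k (\<alpha> ! k) (\<beta> ! k))) (G \<beta>)"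

definition precompute ::
  "nat \<Rightarrow> nat \<Rightarrow> nat list list \<Rightarrow> tensor \<Rightarrow> factors \<Rightarrow> cache timed" where
  "precompute N J obs G A =
     for_each obs (\<lambda>\<alpha>. for_each (core_tuples N J) (\<lambda>\<beta> Pres.
       do { p \<leftarrow> core_product N G A \<alpha> \<beta>; put2 Pres \<alpha> \<beta> p }))
       (\<lambda>_ _. 0)"

text \<open>
  Direct multiplication for a zero divisor: multiply \<open>p\<close> by the factor entries of the listed modes
  and stop as soon as a factor is zero, as the product is then known. The modes are visited
  cyclically, starting behind the current one. A fallback that always performs all \<open>N - 1\<close>
  multiplications would take \<open>N\<^sup>2 |\<Omega>| J\<^sup>N\<close> operations in total when all factor entries are zero.
\<close>

primrec direct_product ::
  "factors \<Rightarrow> nat list \<Rightarrow> nat list \<Rightarrow> nat list \<Rightarrow> real \<Rightarrow> real timed" where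
  "direct_product A \<alpha> \<beta> [] p = ret p"
| "direct_product A \<alpha> \<beta> (k # ks) p =
     do { z \<leftarrow> is_zero (A k (\<alpha> ! k) (\<beta> ! k));
          if z then ret 0
          else do { q \<leftarrow> tmul p (A k (\<alpha> ! k) (\<beta> ! k)); direct_product A \<alpha> \<beta> ks q } }"

definition compute_delta ::
  "nat \<Rightarrow> nat \<Rightarrow> tensor \<Rightarrow> factors \<Rightarrow> cache \<Rightarrow> nat \<Rightarrow> nat list \<Rightarrow> (nat \<Rightarrow> real) timed" where
  "compute_delta N J G A Pres n \<alpha> =
     do { d0 \<leftarrow> for_each [0..<J] (\<lambda>j d. put1 d j 0) (\<lambda>_. 0);
          for_each (core_tuples N J) (\<lambda>\<beta> d.
            do { z \<leftarrow> is_zero (A n (\<alpha> ! n) (\<beta> ! n));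
                 q \<leftarrow> (if z then direct_product A \<alpha> \<beta> ([Suc n..<N] @ [0..<n]) (G \<beta>)
                      else tdiv (Pres \<alpha> \<beta>) (A n (\<alpha> ! n) (\<beta> ! n)));
                 s \<leftarrow> tadd (d (\<beta> ! n)) q;
                 put1 d (\<beta> ! n) s }) d0 }"

definition add_outer ::
  "nat \<Rightarrow> (nat \<Rightarrow> real) \<Rightarrow> (nat \<Rightarrow> nat \<Rightarrow> real) \<Rightarrow> (nat \<Rightarrow> nat \<Rightarrow> real) timed" where
  "add_outer J d = for_each [0..<J] (\<lambda>j. for_each [0..<J] (\<lambda>j' B.
     do { p \<leftarrow> tmul (d j) (d j'); s \<leftarrow> tadd (B j j') p; put2 B j j' s }))"

definition add_scaled ::
  "nat \<Rightarrow> real \<Rightarrow> (nat \<Rightarrow> real) \<Rightarrow> (nat \<Rightarrow> real) \<Rightarrow> (nat \<Rightarrow> real) timed" where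
  "add_scaled J x d = for_each [0..<J] (\<lambda>j c.
     do { p \<leftarrow> tmul x (d j); s \<leftarrow> tadd (c j) p; put1 c j s })"

definition accumulate ::
  "nat \<Rightarrow> nat \<Rightarrow> nat list list \<Rightarrow> tensor \<Rightarrow> tensor \<Rightarrow> factors \<Rightarrow> cache \<Rightarrow> nat \<Rightarrow> nat
     \<Rightarrow> ((nat \<Rightarrow> nat \<Rightarrow> real) \<times> (nat \<Rightarrow> real)) timed" where
  "accumulate N J obs X G A Pres n i =
     do { B0 \<leftarrow> for_each [0..<J] (\<lambda>j. for_each [0..<J] (\<lambda>j' B. put2 B j j' 0)) (\<lambda>_ _. 0);
          c0 \<leftarrow> for_each [0..<J] (\<lambda>j c. put1 c j 0) (\<lambda>_. 0);
          for_each (slice obs n i) (\<lambda>\<alpha> (B, c).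
            do { d \<leftarrow> compute_delta N J G A Pres n \<alpha>;
                 B' \<leftarrow> add_outer J d B;
                 c' \<leftarrow> add_scaled J (X \<alpha>) d c;
                 ret (B', c') }) (B0, c0) }"

definition add_diagonal ::
  "nat \<Rightarrow> real \<Rightarrow> (nat \<Rightarrow> nat \<Rightarrow> real) \<Rightarrow> (nat \<Rightarrow> nat \<Rightarrow> real) timed" where
  "add_diagonal J lam = for_each [0..<J] (\<lambda>j M. do { s \<leftarrow> tadd (M j j) lam; put2 M j j s })"

text \<open>Inverting a \<open>J \<times> J\<close> matrix is a primitive whose cost is the parameter \<open>inv_cost J\<close>.\<close>

definition invert :: "(nat \<Rightarrow> nat) \<Rightarrow> nat \<Rightarrow> (nat \<Rightarrow> nat \<Rightarrow> real) \<Rightarrow> real mat timed" where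
  "invert inv_cost J M = Timed (the (mat_inverse (mat J J (\<lambda>(i, j). M i j)))) (inv_cost J)"

definition row_times_mat :: "nat \<Rightarrow> (nat \<Rightarrow> real) \<Rightarrow> real mat \<Rightarrow> (nat \<Rightarrow> real) timed" where
  "row_times_mat J c M = for_each [0..<J] (\<lambda>j r.
     do { s \<leftarrow> for_each [0..<J] (\<lambda>l s. do { p \<leftarrow> tmul (c l) (M $$ (l, j)); tadd s p }) 0;
          put1 r j s }) (\<lambda>_. 0)"

definition update_row ::
  "(nat \<Rightarrow> nat) \<Rightarrow> nat \<Rightarrow> nat \<Rightarrow> nat list list \<Rightarrow> tensor \<Rightarrow> tensor \<Rightarrow> real \<Rightarrow> cache \<Rightarrow> nat
     \<Rightarrow> nat \<Rightarrow> factors \<Rightarrow> factors timed" where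
  "update_row inv_cost N J obs X G lam Pres n i A =
     do { (B, c) \<leftarrow> accumulate N J obs X G A Pres n i;
          M \<leftarrow> add_diagonal J lam B;
          Minv \<leftarrow> invert inv_cost J M;
          r \<leftarrow> row_times_mat J c Minv;
          for_each [0..<J] (\<lambda>j A'. do { R \<leftarrow> put2 (A' n) i j (r j); ret (A'(n := R)) }) A }"

definition copy_matrix ::
  "nat \<Rightarrow> nat \<Rightarrow> (nat \<Rightarrow> nat \<Rightarrow> real) \<Rightarrow> (nat \<Rightarrow> nat \<Rightarrow> real) timed" where
  "copy_matrix I J M = for_each [0..<I] (\<lambda>i. for_each [0..<J] (\<lambda>j C. put2 C i j (M i j)))
     (\<lambda>_ _. 0)"

text \<open>\<open>Aold\<close> is the \<open>n\<close>-th factor matrix before its update, \<open>A\<close> contains the updated one.\<close>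

definition update_cache ::
  "nat \<Rightarrow> nat \<Rightarrow> nat list list \<Rightarrow> tensor \<Rightarrow> (nat \<Rightarrow> nat \<Rightarrow> real) \<Rightarrow> factors \<Rightarrow> nat
     \<Rightarrow> cache \<Rightarrow> cache timed" where
  "update_cache N J obs G Aold A n =
     for_each obs (\<lambda>\<alpha>. for_each (core_tuples N J) (\<lambda>\<beta> Pres.
       do { z \<leftarrow> is_zero (Aold (\<alpha> ! n) (\<beta> ! n));
            p \<leftarrow> (if z then direct_product A \<alpha> \<beta> ([n..<N] @ [0..<n]) (G \<beta>)
                 else do { q \<leftarrow> tdiv (Pres \<alpha> \<beta>) (Aold (\<alpha> ! n) (\<beta> ! n));
                           tmul q (A n (\<alpha> ! n) (\<beta> ! n)) });
            put2 Pres \<alpha> \<beta> p }))"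

definition update_mode ::
  "(nat \<Rightarrow> nat) \<Rightarrow> nat \<Rightarrow> nat \<Rightarrow> nat \<Rightarrow> nat list list \<Rightarrow> tensor \<Rightarrow> tensor \<Rightarrow> real \<Rightarrow> nat
     \<Rightarrow> factors \<times> cache \<Rightarrow> (factors \<times> cache) timed" where
  "update_mode inv_cost N I J obs X G lam n = (\<lambda>(A, Pres).
     do { Aold \<leftarrow> copy_matrix I J (A n);
          A' \<leftarrow> for_each [0..<I] (update_row inv_cost N J obs X G lam Pres n) A;
          Pres' \<leftarrow> update_cache N J obs G Aold A' n Pres;
          ret (A', Pres') })"

definition reconstruction_error ::
  "nat \<Rightarrow> nat \<Rightarrow> nat list list \<Rightarrow> tensor \<Rightarrow> tensor \<Rightarrow> factors \<Rightarrow> real timed" where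
  "reconstruction_error N J obs X G A =
     do { e \<leftarrow> for_each obs (\<lambda>\<alpha> e.
            do { x \<leftarrow> for_each (core_tuples N J) (\<lambda>\<beta> x.
                   do { p \<leftarrow> core_product N G A \<alpha> \<beta>; tadd x p }) 0;
                 r \<leftarrow> tsub (X \<alpha>) x;
                 q \<leftarrow> tmul r r;
                 tadd e q }) 0;
          tsqrt e }"

definition ptucker_cache_iteration ::
  "(nat \<Rightarrow> nat) \<Rightarrow> nat \<Rightarrow> nat \<Rightarrow> nat \<Rightarrow> nat list list \<Rightarrow> tensor \<Rightarrow> tensor \<Rightarrow> real \<Rightarrow> factors
     \<Rightarrow> (factors \<times> real) timed" where
  "ptucker_cache_iteration inv_cost N I J obs X G lam A =
     do { Pres \<leftarrow> precompute N J obs G A;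
          (A', Pres') \<leftarrow> for_each [0..<N] (update_mode inv_cost N I J obs X G lam) (A, Pres);
          err \<leftarrow> reconstruction_error N J obs X G A';
          ret (A', err) }"

end

theory Submission
  imports Defs
begin

text \<open>
  The delicate part is the cost of the zero-divisor fallback, which may take up to \<open>2N\<close>
  operations for a single pair \<open>(\<alpha>, \<beta>)\<close> and a single mode. When mode \<open>n\<close> is processed, the
  factors of the modes \<open>k > n\<close> and the row of mode \<open>n\<close> in use still have their initial values.
  A fallback started at mode \<open>n\<close> therefore stops at the latest at the next mode whose initial
  entry is zero, and only the last initially zero mode can cause a wrap-around. Measured by the
  distances between consecutive initial zeros, the fallback costs for \<open>(\<alpha>, \<beta>)\<close> telescope over
  the modes to \<open>O(N)\<close>. The \<open>J\<^sup>2 |\<Omega>|\<close> operations per mode for the matrices \<open>B\<close> are covered by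
  \<open>|\<Omega>| J\<^sup>N\<close> if \<open>N \<ge> 2\<close>, and by \<open>I J\<^sup>3\<close> if \<open>N = 1\<close>, as then \<open>|\<Omega>| \<le> I\<close>.
\<close>

section \<open>Counting operations\<close>

lemma timed_simps [simp]:
  "steps (ret x) = 0" "result (ret x) = x"
  "steps (tick x) = 1" "result (tick x) = x"
  "steps (tbind m f) = steps m + steps (f (result m))"
  "result (tbind m f) = result (f (result m))"
  "steps (tadd a b) = 1" "steps (tsub a b) = 1" "steps (tmul a b) = 1"
  "steps (tdiv a b) = 1" "steps (tsqrt a) = 1"
  "steps (is_zero a) = 1" "result (is_zero a) = (a = 0)"
  "steps (put1 g i y) = 1" "steps (put2 h i j w) = 1"
  by (simp_all add: ret_def tick_def tbind_def tadd_def tsub_def tmul_def tdiv_def tsqrt_def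
      is_zero_def put1_def put2_def)

text \<open>The \<open>Suc\<close> pays for the loop pass. The cost of the body may depend on the
  loop index but is bounded uniformly in the state.\<close>

lemma steps_for_each_le:
  assumes "\<And>x s. x \<in> set xs \<Longrightarrow> steps (body x s) \<le> f x"
  shows "steps (for_each xs body s) \<le> (\<Sum>x\<leftarrow>xs. Suc (f x))"
  using assms
proof (induction xs arbitrary: s)
  case (Cons x xs)
  have "steps (body x s) \<le> f x" using Cons.prems by simp
  moreover have "steps (for_each xs body (result (body x s))) \<le> (\<Sum>x\<leftarrow>xs. Suc (f x))"
    using Cons by simp
  ultimately show ?case by simp
qed simp

lemma steps_for_each_const_le:
  assumes "\<And>x s. x \<in> set xs \<Longrightarrow> steps (body x s) \<le> c"
  shows "steps (for_each xs body s) \<le> length xs * Suc c"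
  using steps_for_each_le[of xs body "\<lambda>_. c" s] assms by (simp add: sum_list_triv)

text \<open>The costs of rows and modes are bounded only in states where the entries still to be
  tested have their initial values. Cost and invariant are therefore carried through one
  induction.\<close>

lemma for_each_upt_invariant:
  assumes "m \<le> n" "P m s"
    and "\<And>i s. m \<le> i \<Longrightarrow> i < n \<Longrightarrow> P i s \<Longrightarrow> steps (body i s) \<le> f i \<and> P (Suc i) (result (body i s))"
  shows "steps (for_each [m..<n] body s) \<le> (\<Sum>i = m..<n. Suc (f i))
    \<and> P n (result (for_each [m..<n] body s))"
  using assms
proof (induction arbitrary: s rule: inc_induct)
  case (step m)
  have *: "steps (body m s) \<le> f m" "P (Suc m) (result (body m s))"
    using step by auto
  have "steps (for_each [Suc m..<n] body (result (body m s))) \<le> (\<Sum>i = Suc m..<n. Suc (f i))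
    \<and> P n (result (for_each [Suc m..<n] body (result (body m s))))"
    by (rule step.IH) (use * step.prems in auto)
  with *(1) step.hyps show ?case
    by (simp add: upt_conv_Cons sum.atLeast_Suc_lessThan)
qed simp

lemma result_for_each_upt_invariant:
  assumes "m \<le> n" "P m s"
    and "\<And>i s. m \<le> i \<Longrightarrow> i < n \<Longrightarrow> P i s \<Longrightarrow> P (Suc i) (result (body i s))"
  shows "P n (result (for_each [m..<n] body s))"
  using assms
proof (induction arbitrary: s rule: inc_induct)
  case (step m)
  have "P n (result (for_each [Suc m..<n] body (result (body m s))))"
    by (rule step.IH) (use step.prems step.hyps in auto)
  with step.hyps show ?case
    by (simp add: upt_conv_Cons)
qed simp

section \<open>Distances between zeros\<close>

text \<open>The value \<open>2N\<close> in the absence of a further zero pays for the wrap-around.\<close>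

definition next_zero :: "(nat \<Rightarrow> bool) \<Rightarrow> nat \<Rightarrow> nat \<Rightarrow> nat" where
  "next_zero z N n = Min (insert (2 * N) {k \<in> {n..<N}. z k})"

text \<open>For n < N the gap is 0 unless \<open>z n\<close> holds, so only modes with an initial
  zero, those that trigger a fallback, carry a budget.\<close>

definition zero_gap :: "(nat \<Rightarrow> bool) \<Rightarrow> nat \<Rightarrow> nat \<Rightarrow> nat" where
  "zero_gap z N n = next_zero z N (Suc n) - next_zero z N n"

lemma next_zero_ge: "n \<le> N \<Longrightarrow> n \<le> next_zero z N n"
  by (auto simp: next_zero_def)

lemma next_zero_end [simp]: "next_zero z N N = 2 * N"
  by (simp add: next_zero_def)

lemma next_zero_rec:
  assumes "n < N"
  shows "next_zero z N n = (if z n then n else next_zero z N (Suc n))"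
proof (cases "z n")
  case True
  then have "next_zero z N n = n"
    unfolding next_zero_def by (intro Min_eqI) (use assms in auto)
  with True show ?thesis by simp
next
  case False
  then have "{k \<in> {n..<N}. z k} = {k \<in> {Suc n..<N}. z k}"
    by (auto simp: Suc_le_eq le_less)
  with False show ?thesis by (simp add: next_zero_def)
qed

lemma sum_zero_gap: "(\<Sum>n<N. zero_gap z N n) \<le> 2 * N"
proof -
  \<comment> \<open>With \<open>next_zero z N 0\<close> moved to the left, the telescoping identity
    needs no subtraction.\<close>
  have "m \<le> N \<Longrightarrow> (\<Sum>n<m. zero_gap z N n) + next_zero z N 0 = next_zero z N m" for m
  proof (induction m)
    case (Suc m)
    \<comment> \<open>This monotonicity makes the natural subtraction inside \<open>zero_gap\<close>
      exact.\<close>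
    have "next_zero z N m \<le> next_zero z N (Suc m)"
      using Suc.prems next_zero_ge[of "Suc m" N z] by (simp add: next_zero_rec[of m N z])
    with Suc show ?case by (simp add: zero_gap_def)
  qed simp
  from this[of N] show ?thesis by simp
qed

section \<open>Fallback cost in terms of zero gaps\<close>

lemma steps_direct_product_le_length: "steps (direct_product A \<alpha> \<beta> ks p) \<le> 2 * length ks"
proof (induction ks arbitrary: p)
  case (Cons k ks)
  from this[of "result (tmul p (A k (\<alpha> ! k) (\<beta> ! k)))"] show ?case by simp
qed simp

text \<open>A visited mode costs at most a zero test and a multiplication, and the run ends at the
  first zero from \<open>m\<close> on. If there is none, all of \<open>ks\<close> may be traversed
  as well; the default \<open>2 * N\<close> then leaves N - m for the rest of the range and N for
  \<open>ks\<close>.\<close>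

lemma steps_direct_product_le_next_zero:
  assumes "m \<le> N" "length ks \<le> N"
    and "\<And>k. m \<le> k \<Longrightarrow> k < N \<Longrightarrow> A k (\<alpha> ! k) (\<beta> ! k) = 0 \<longleftrightarrow> z k"
  shows "steps (direct_product A \<alpha> \<beta> ([m..<N] @ ks) p) \<le> 2 * (next_zero z N m - m + 1)"
  using assms
proof (induction arbitrary: p rule: inc_induct)
  case base
  then show ?case using steps_direct_product_le_length[of A \<alpha> \<beta> ks p] by simp
next
  case (step m)
  show ?case
  proof (cases "z m")
    case True
    with step show ?thesis by (simp add: upt_conv_Cons)
  next
    case False
    have "steps (direct_product A \<alpha> \<beta> ([Suc m..<N] @ ks) q)
        \<le> 2 * (next_zero z N (Suc m) - Suc m + 1)" for q
      by (rule step.IH) (use step.prems in auto)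
    from this[of "result (tmul p (A m (\<alpha> ! m) (\<beta> ! m)))"]
    have "steps (direct_product A \<alpha> \<beta> ([Suc m..<N] @ ks) (result (tmul p (A m (\<alpha> ! m) (\<beta> ! m)))))
        \<le> 2 * (next_zero z N (Suc m) - Suc m + 1)" .
    \<comment> \<open>Writing the next zero as \<open>Suc m + d\<close> eliminates the truncated
      subtractions.\<close>
    moreover obtain d where "next_zero z N (Suc m) = Suc m + d"
      using step.hyps next_zero_ge[of "Suc m" N z] le_Suc_ex Suc_leI by blast
    moreover have "next_zero z N m = next_zero z N (Suc m)"
      using False step.hyps by (simp add: next_zero_rec[of m N z])
    moreover have "A m (\<alpha> ! m) (\<beta> ! m) \<noteq> 0"
      using False step.hyps step.prems(2)[of m] by simp
    then have "steps (direct_product A \<alpha> \<beta> ([m..<N] @ ks) p)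
        = 2 + steps (direct_product A \<alpha> \<beta> ([Suc m..<N] @ ks) (result (tmul p (A m (\<alpha> ! m) (\<beta> ! m)))))"
      using step.hyps by (simp add: upt_conv_Cons)
    ultimately show ?thesis by simp
  qed
qed

text \<open>By \<open>z n\<close> the next zero from n on is n itself, so the bound for the start
  \<open>Suc n\<close> is exactly twice the gap. Modes below n may already be updated; they occur
  only in the wrapped part, which is bounded by its length alone.\<close>

lemma steps_direct_product_behind:
  assumes "n < N" "z n"
    and "\<And>k. n < k \<Longrightarrow> k < N \<Longrightarrow> A k (\<alpha> ! k) (\<beta> ! k) = 0 \<longleftrightarrow> z k"
  shows "steps (direct_product A \<alpha> \<beta> ([Suc n..<N] @ [0..<n]) p) \<le> 2 * zero_gap z N n"
proof -
  have "steps (direct_product A \<alpha> \<beta> ([Suc n..<N] @ [0..<n]) p)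
      \<le> 2 * (next_zero z N (Suc n) - Suc n + 1)"
    using assms by (intro steps_direct_product_le_next_zero) auto
  \<comment> \<open>Ensures that subtracting \<open>Suc n\<close> and adding 1 amounts to
    subtracting n.\<close>
  moreover have "Suc n \<le> next_zero z N (Suc n)"
    using assms by (intro next_zero_ge) auto
  ultimately show ?thesis
    using assms by (simp add: zero_gap_def next_zero_rec[of n N z])
qed

text \<open>Mode n comes first, with its new entry, which may be nonzero although \<open>z n\<close>
  describes the old one. The extra 2 pays for testing and multiplying by it.\<close>

lemma steps_direct_product_from:
  assumes "n < N" "z n"
    and "\<And>k. n < k \<Longrightarrow> k < N \<Longrightarrow> A k (\<alpha> ! k) (\<beta> ! k) = 0 \<longleftrightarrow> z k"
  shows "steps (direct_product A \<alpha> \<beta> ([n..<N] @ [0..<n]) p) \<le> 2 + 2 * zero_gap z N n"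
  using steps_direct_product_behind[of n N z A \<alpha> \<beta>, OF assms] assms(1)
  by (simp add: upt_conv_Cons)

section \<open>The parts of an iteration\<close>

lemma sum_sum_list_swap:
  "(\<Sum>n\<in>S. \<Sum>x\<leftarrow>xs. f n x) = (\<Sum>x\<leftarrow>xs. \<Sum>n\<in>S. f n x)"
  for f :: "'a \<Rightarrow> 'b \<Rightarrow> nat"
  by (induction xs) (simp_all add: sum.distrib)

definition zero_entry :: "factors \<Rightarrow> nat list \<Rightarrow> nat list \<Rightarrow> nat \<Rightarrow> bool" where
  "zero_entry A \<alpha> \<beta> k \<longleftrightarrow> A k (\<alpha> ! k) (\<beta> ! k) = 0"

text \<open>The fallback budget of \<alpha> in mode n. It is eventually used with the factors at the
  start of the iteration.\<close>

definition tuple_gap :: "nat \<Rightarrow> nat \<Rightarrow> factors \<Rightarrow> nat \<Rightarrow> nat list \<Rightarrow> nat" where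
  "tuple_gap N J A n \<alpha> = (\<Sum>\<beta>\<leftarrow>core_tuples N J. zero_gap (zero_entry A \<alpha> \<beta>) N n)"

lemma length_core_tuples [simp]: "length (core_tuples N J) = J ^ N"
  by (simp add: core_tuples_def length_n_lists)

lemma nth_core_tuple_less: "\<beta> \<in> set (core_tuples N J) \<Longrightarrow> n < N \<Longrightarrow> \<beta> ! n < J"
  using nth_mem[of n \<beta>] by (force simp: core_tuples_def set_n_lists)

lemma sum_tuple_gap: "(\<Sum>n<N. tuple_gap N J A n \<alpha>) \<le> 2 * N * J ^ N"
proof -
  have "(\<Sum>n<N. tuple_gap N J A n \<alpha>)
      = (\<Sum>\<beta>\<leftarrow>core_tuples N J. \<Sum>n<N. zero_gap (zero_entry A \<alpha> \<beta>) N n)"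
    unfolding tuple_gap_def by (rule sum_sum_list_swap)
  also have "\<dots> \<le> (\<Sum>\<beta>\<leftarrow>core_tuples N J. 2 * N)"
    by (intro sum_list_mono sum_zero_gap)
  finally show ?thesis by (simp add: sum_list_triv mult.commute)
qed

section \<open>Precomputation and reconstruction error\<close>

lemma steps_core_product: "steps (core_product N G A \<alpha> \<beta>) \<le> 2 * N"
  using steps_for_each_const_le[of "[0..<N]" "\<lambda>k p. tmul p (A k (\<alpha> ! k) (\<beta> ! k))" 1 "G \<beta>"]
  by (simp add: core_product_def)

lemma steps_precompute:
  "steps (precompute N J obs G A) \<le> length obs * Suc (J ^ N * (2 * N + 2))"
  unfolding precompute_def
proof (rule steps_for_each_const_le)
  fix \<alpha> Pres
  show "steps (for_each (core_tuples N J) (\<lambda>\<beta> Pres.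
       do { p \<leftarrow> core_product N G A \<alpha> \<beta>; put2 Pres \<alpha> \<beta> p }) Pres) \<le> J ^ N * (2 * N + 2)"
    by (rule order.trans[OF steps_for_each_const_le[where c = "2 * N + 1"]])
      (simp_all add: steps_core_product)
qed

lemma steps_reconstruction_error:
  "steps (reconstruction_error N J obs X G A) \<le> length obs * Suc (J ^ N * (2 * N + 2) + 3) + 1"
proof -
  let ?entry = "\<lambda>\<alpha>. for_each (core_tuples N J) (\<lambda>\<beta> x.
       do { p \<leftarrow> core_product N G A \<alpha> \<beta>; tadd x p }) 0"
  have entry: "steps (?entry \<alpha>) \<le> J ^ N * (2 * N + 2)" for \<alpha>
    by (rule order.trans[OF steps_for_each_const_le[where c = "2 * N + 1"]])
      (simp_all add: steps_core_product)
  have "steps (for_each obs (\<lambda>\<alpha> e. do { x \<leftarrow> ?entry \<alpha>; r \<leftarrow> tsub (X \<alpha>) x; q \<leftarrow> tmul r r; tadd e q }) 0)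
      \<le> length obs * Suc (J ^ N * (2 * N + 2) + 3)"
  proof (rule steps_for_each_const_le)
    fix \<alpha> e
    show "steps (do { x \<leftarrow> ?entry \<alpha>; r \<leftarrow> tsub (X \<alpha>) x; q \<leftarrow> tmul r r; tadd e q })
        \<le> J ^ N * (2 * N + 2) + 3"
      using entry[of \<alpha>] by simp
  qed
  then show ?thesis
    by (simp add: reconstruction_error_def)
qed

text \<open>\<open>A0\<close> stands for the initial factors. Modes below n and the other rows of
  mode n are unconstrained, as they may already be updated. A core tuple costs at most four
  operations plus twice its gap; the fifth is the loop pass.\<close>

lemma steps_compute_delta:
  assumes "n < N" "A n (\<alpha> ! n) = A0 n (\<alpha> ! n)" "\<And>k. n < k \<Longrightarrow> A k = A0 k"
  shows "steps (compute_delta N J G A Pres n \<alpha>) \<le> 2 * J + 5 * J ^ N + 2 * tuple_gap N J A0 n \<alpha>"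
proof -
  let ?body = "\<lambda>\<beta> d. do { z \<leftarrow> is_zero (A n (\<alpha> ! n) (\<beta> ! n));
                 q \<leftarrow> (if z then direct_product A \<alpha> \<beta> ([Suc n..<N] @ [0..<n]) (G \<beta>)
                      else tdiv (Pres \<alpha> \<beta>) (A n (\<alpha> ! n) (\<beta> ! n)));
                 s \<leftarrow> tadd (d (\<beta> ! n)) q;
                 put1 d (\<beta> ! n) s }"
  let ?gap = "\<lambda>\<beta>. zero_gap (zero_entry A0 \<alpha> \<beta>) N n"
  have init: "steps (for_each [0..<J] (\<lambda>j d. put1 d j (0::real)) (\<lambda>_. 0)) \<le> 2 * J"
    by (rule order.trans[OF steps_for_each_const_le[where c = 1]]) simp_all
  have "steps (?body \<beta> d) \<le> 4 + 2 * ?gap \<beta>" for \<beta> and d :: "nat \<Rightarrow> real"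
  proof (cases "A n (\<alpha> ! n) (\<beta> ! n) = 0")
    case True
    then have "steps (direct_product A \<alpha> \<beta> ([Suc n..<N] @ [0..<n]) (G \<beta>)) \<le> 2 * ?gap \<beta>"
      using assms by (intro steps_direct_product_behind) (simp_all add: zero_entry_def)
    with True show ?thesis by simp
  qed simp
  then have "steps (for_each (core_tuples N J) ?body s) \<le> (\<Sum>\<beta>\<leftarrow>core_tuples N J. Suc (4 + 2 * ?gap \<beta>))" for s
    by (intro steps_for_each_le)
  also have "\<dots> = 5 * J ^ N + 2 * tuple_gap N J A0 n \<alpha>"
    by (simp add: tuple_gap_def sum_list_addf sum_list_const_mult sum_list_triv flip: add_Suc)
  finally show ?thesis
    unfolding compute_delta_def using init by (simp add: add_mono add.assoc)
qed

section \<open>Loops whose cost does not depend on the data\<close>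

lemma steps_add_outer: "steps (add_outer J d B) \<le> J * (4 * J + 1)"
proof -
  have inner: "steps (for_each [0..<J] (\<lambda>j' B.
     do { p \<leftarrow> tmul (d j) (d j'); s \<leftarrow> tadd (B j j') p; put2 B j j' s }) B) \<le> 4 * J" for j B
    by (rule order.trans[OF steps_for_each_const_le[where c = 3]]) simp_all
  show ?thesis
    unfolding add_outer_def
    by (rule order.trans[OF steps_for_each_const_le[where c = "4 * J"]]) (simp_all add: inner)
qed

lemma steps_add_scaled: "steps (add_scaled J x d c) \<le> 4 * J"
  unfolding add_scaled_def
  by (rule order.trans[OF steps_for_each_const_le[where c = 3]]) simp_all

lemma steps_add_diagonal: "steps (add_diagonal J lam M) \<le> 3 * J"
  unfolding add_diagonal_def
  by (rule order.trans[OF steps_for_each_const_le[where c = 2]]) simp_all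

lemma steps_row_times_mat: "steps (row_times_mat J c M) \<le> J * (3 * J + 2)"
proof -
  have inner: "steps (for_each [0..<J] (\<lambda>l s. do { p \<leftarrow> tmul (c l) (M $$ (l, j)); tadd s p }) 0) \<le> 3 * J" for j
    by (rule order.trans[OF steps_for_each_const_le[where c = 2]]) simp_all
  show ?thesis
    unfolding row_times_mat_def
    by (rule order.trans[OF steps_for_each_const_le[where c = "3 * J + 1"]]) (simp_all add: inner)
qed

lemma steps_fill_matrix:
  "steps (for_each [0..<I] (\<lambda>i. for_each [0..<J] (\<lambda>j C. put2 C i j (M i j))) C) \<le> I * (2 * J + 1)"
proof -
  have inner: "steps (for_each [0..<J] (\<lambda>j C. put2 C i j (M i j)) C) \<le> 2 * J" for i C
    by (rule order.trans[OF steps_for_each_const_le[where c = 1]]) simp_all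
  show ?thesis
    by (rule order.trans[OF steps_for_each_const_le[where c = "2 * J"]]) (simp_all add: inner)
qed

text \<open>The term before the sum pays for zeroing B and c. In the summand,
  \<open>J * (4 * J + 7)\<close> collects zeroing \<delta>, the outer product and the scaled
  addition: 2J + J(4J + 1) + 4J.\<close>

lemma steps_accumulate:
  assumes "n < N" "A n i = A0 n i" "\<And>k. n < k \<Longrightarrow> A k = A0 k"
  shows "steps (accumulate N J obs X G A Pres n i)
    \<le> J * (2 * J + 3)
      + (\<Sum>\<alpha>\<leftarrow>slice obs n i. 1 + J * (4 * J + 7) + 5 * J ^ N + 2 * tuple_gap N J A0 n \<alpha>)"
proof -
  let ?body = "\<lambda>\<alpha> (B, c). do { d \<leftarrow> compute_delta N J G A Pres n \<alpha>;
                 B' \<leftarrow> add_outer J d B;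
                 c' \<leftarrow> add_scaled J (X \<alpha>) d c;
                 ret (B', c') }"
  have init: "steps (for_each [0..<J] (\<lambda>j c. put1 c j (0::real)) (\<lambda>_. 0)) \<le> 2 * J"
    by (rule order.trans[OF steps_for_each_const_le[where c = 1]]) simp_all
  have init': "steps (for_each [0..<J] (\<lambda>j. for_each [0..<J] (\<lambda>j' B. put2 B j j' (0::real))) (\<lambda>_ _. 0))
      \<le> J * (2 * J + 1)"
    by (rule steps_fill_matrix)
  have "steps (?body \<alpha> s) \<le> J * (4 * J + 7) + 5 * J ^ N + 2 * tuple_gap N J A0 n \<alpha>"
    if "\<alpha> \<in> set (slice obs n i)" for \<alpha> s
  proof -
    obtain B c where s: "s = (B, c)" by (cases s)
    have "steps (compute_delta N J G A Pres n \<alpha>) \<le> 2 * J + 5 * J ^ N + 2 * tuple_gap N J A0 n \<alpha>"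
      using assms that by (intro steps_compute_delta) (auto simp: slice_def)
    with steps_add_outer[of J "result (compute_delta N J G A Pres n \<alpha>)" B]
      steps_add_scaled[of J "X \<alpha>" "result (compute_delta N J G A Pres n \<alpha>)" c]
    show ?thesis by (simp add: s algebra_simps)
  qed
  then have "steps (for_each (slice obs n i) ?body s)
      \<le> (\<Sum>\<alpha>\<leftarrow>slice obs n i. Suc (J * (4 * J + 7) + 5 * J ^ N + 2 * tuple_gap N J A0 n \<alpha>))" for s
    by (rule steps_for_each_le)
  note this[of "(result (for_each [0..<J] (\<lambda>j. for_each [0..<J] (\<lambda>j' B. put2 B j j' (0::real))) (\<lambda>_ _. 0)),
     result (for_each [0..<J] (\<lambda>j c. put1 c j (0::real)) (\<lambda>_. 0)))"]
  with init init' show ?thesis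
    unfolding accumulate_def by (simp add: algebra_simps)
qed

lemma steps_update_row:
  assumes "n < N" "A n i = A0 n i" "\<And>k. n < k \<Longrightarrow> A k = A0 k"
  shows "steps (update_row inv_cost N J obs X G lam Pres n i A)
    \<le> J * (5 * J + 10) + inv_cost J
      + (\<Sum>\<alpha>\<leftarrow>slice obs n i. 1 + J * (4 * J + 7) + 5 * J ^ N + 2 * tuple_gap N J A0 n \<alpha>)"
proof -
  have store: "steps (for_each [0..<J] (\<lambda>j A'. do { R \<leftarrow> put2 (A' n) i j (r j); ret (A'(n := R)) }) A)
      \<le> 2 * J" for r :: "nat \<Rightarrow> real"
    by (rule order.trans[OF steps_for_each_const_le[where c = 1]]) simp_all
  obtain B c where Bc: "result (accumulate N J obs X G A Pres n i) = (B, c)"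
    by fastforce
  define Minv where "Minv = result (invert inv_cost J (result (add_diagonal J lam B)))"
  have "steps (invert inv_cost J M) = inv_cost J" for M
    by (simp add: invert_def)
  with steps_accumulate[of n N A i A0 J obs X G Pres] assms
    steps_add_diagonal[of J lam B] steps_row_times_mat[of J c Minv]
    store[of "result (row_times_mat J c Minv)"]
  show ?thesis
    unfolding update_row_def by (simp add: Bc Minv_def algebra_simps)
qed

text \<open>This preserves initial values: rows and modes processed later are still untouched when
  their turn comes.\<close>

lemma update_row_changes_only:
  assumes "k \<noteq> n \<or> i' \<noteq> i"
  shows "result (update_row inv_cost N J obs X G lam Pres n i A) k i' = A k i'"
proof -
  have "result (for_each [0..<J] (\<lambda>j A'. do { R \<leftarrow> put2 (A' n) i j (r j); ret (A'(n := R)) }) A) k i' = A k i'"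
    for r :: "nat \<Rightarrow> real"
    by (rule result_for_each_upt_invariant[where P = "\<lambda>_ A'. A' k i' = A k i'"])
      (use assms in \<open>auto simp: put2_def\<close>)
  then show ?thesis
    by (simp add: update_row_def case_prod_beta)
qed

text \<open>The cache update tests the copy for zeros, so its fallbacks can be charged to initial
  zeros only where the copy is faithful. Outside the range the copy is 0.\<close>

lemma result_copy_matrix:
  assumes "i < I" "j < J"
  shows "result (copy_matrix I J M) i j = M i j"
proof -
  have row: "\<forall>i' j'. result (for_each [0..<J] (\<lambda>j C. put2 C i j (M i j)) C) i' j'
      = (if i' = i \<and> j' < J then M i j' else C i' j')" for i C
    by (rule result_for_each_upt_invariant
        [where P = "\<lambda>m C'. \<forall>i' j'. C' i' j' = (if i' = i \<and> j' < m then M i j' else C i' j')"])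
      (auto simp: put2_def less_Suc_eq)
  have "\<forall>i'<I. \<forall>j'<J. result (copy_matrix I J M) i' j' = M i' j'"
    unfolding copy_matrix_def
    by (rule result_for_each_upt_invariant[where P = "\<lambda>m C. \<forall>i'<m. \<forall>j'<J. C i' j' = M i' j'"])
      (auto simp: row less_Suc_eq)
  with assms show ?thesis by simp
qed

lemma steps_update_cache:
  assumes "n < N" "\<And>k. n < k \<Longrightarrow> A k = A0 k"
    and "\<And>\<alpha> j. \<alpha> \<in> set obs \<Longrightarrow> j < J \<Longrightarrow> Aold (\<alpha> ! n) j = A0 n (\<alpha> ! n) j"
  shows "steps (update_cache N J obs G Aold A n Pres)
    \<le> (\<Sum>\<alpha>\<leftarrow>obs. 1 + 5 * J ^ N + 2 * tuple_gap N J A0 n \<alpha>)"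
proof -
  let ?body = "\<lambda>\<alpha> \<beta> Pres. do { z \<leftarrow> is_zero (Aold (\<alpha> ! n) (\<beta> ! n));
            p \<leftarrow> (if z then direct_product A \<alpha> \<beta> ([n..<N] @ [0..<n]) (G \<beta>)
                 else do { q \<leftarrow> tdiv (Pres \<alpha> \<beta>) (Aold (\<alpha> ! n) (\<beta> ! n));
                           tmul q (A n (\<alpha> ! n) (\<beta> ! n)) });
            put2 Pres \<alpha> \<beta> p }"
  let ?gap = "\<lambda>\<alpha> \<beta>. zero_gap (zero_entry A0 \<alpha> \<beta>) N n"
  have "steps (for_each (core_tuples N J) (?body \<alpha>) Pres) \<le> 5 * J ^ N + 2 * tuple_gap N J A0 n \<alpha>"
    if "\<alpha> \<in> set obs" for \<alpha> Pres
  proof -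
    have "steps (?body \<alpha> \<beta> Pres) \<le> 4 + 2 * ?gap \<alpha> \<beta>" if "\<beta> \<in> set (core_tuples N J)" for \<beta> Pres
    proof (cases "Aold (\<alpha> ! n) (\<beta> ! n) = 0")
      case True
      \<comment> \<open>Membership of \<beta> gives a column below J, where \<open>Aold\<close>
        agrees with \<open>A0\<close>.\<close>
      then have "zero_entry A0 \<alpha> \<beta> n"
        using assms(1,3) \<open>\<alpha> \<in> set obs\<close> nth_core_tuple_less[OF that] by (simp add: zero_entry_def)
      then have "steps (direct_product A \<alpha> \<beta> ([n..<N] @ [0..<n]) (G \<beta>)) \<le> 2 + 2 * ?gap \<alpha> \<beta>"
        using assms by (intro steps_direct_product_from) (simp_all add: zero_entry_def)
      with True show ?thesis by simp
    qed simp
    then have "steps (for_each (core_tuples N J) (?body \<alpha>) Pres)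
        \<le> (\<Sum>\<beta>\<leftarrow>core_tuples N J. Suc (4 + 2 * ?gap \<alpha> \<beta>))"
      by (rule steps_for_each_le)
    then show ?thesis
      by (simp add: tuple_gap_def sum_list_addf sum_list_const_mult sum_list_triv flip: add_Suc)
  qed
  then have "steps (update_cache N J obs G Aold A n Pres)
      \<le> (\<Sum>\<alpha>\<leftarrow>obs. Suc (5 * J ^ N + 2 * tuple_gap N J A0 n \<alpha>))"
    unfolding update_cache_def by (rule steps_for_each_le)
  then show ?thesis by simp
qed

section \<open>From rows to a whole mode\<close>

lemma sum_list_affine: "(\<Sum>x\<leftarrow>xs. c + 2 * f x) = length xs * c + 2 * (\<Sum>x\<leftarrow>xs. f x)"
  for f :: "'a \<Rightarrow> nat"
  by (induction xs) simp_all

text \<open>Each observed tuple lies in exactly one slice, so all rows of a mode together process it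
  once.\<close>

lemma sum_slices:
  fixes f :: "nat list \<Rightarrow> nat"
  assumes "\<And>\<alpha>. \<alpha> \<in> set obs \<Longrightarrow> \<alpha> ! n < I"
  shows "(\<Sum>i<I. \<Sum>\<alpha>\<leftarrow>slice obs n i. f \<alpha>) = (\<Sum>\<alpha>\<leftarrow>obs. f \<alpha>)"
  using assms
proof (induction obs)
  case (Cons \<alpha> obs)
  have "(\<Sum>i<I. \<Sum>\<gamma>\<leftarrow>slice (\<alpha> # obs) n i. f \<gamma>)
      = (\<Sum>i<I. (if \<alpha> ! n = i then f \<alpha> else 0) + (\<Sum>\<gamma>\<leftarrow>slice obs n i. f \<gamma>))"
    by (intro sum.cong) (auto simp: slice_def)
  with Cons show ?case by (simp add: sum.distrib)
qed (simp add: slice_def)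

text \<open>The factor 4 arises because computing \<delta> and updating the cache each pay twice the
  gap. The second conclusion restores the hypothesis on \<open>A\<close> for the next mode.\<close>

lemma update_mode_bound:
  assumes n: "n < N" and A: "\<And>k. n \<le> k \<Longrightarrow> A k = A0 k"
    and obs: "\<And>\<alpha>. \<alpha> \<in> set obs \<Longrightarrow> \<alpha> ! n < I"
  shows "steps (update_mode inv_cost N I J obs X G lam n (A, Pres))
    \<le> I * (5 * J ^ 2 + 12 * J + 2 + inv_cost J) + length obs * (4 * J ^ 2 + 7 * J + 2 + 10 * J ^ N)
      + 4 * (\<Sum>\<alpha>\<leftarrow>obs. tuple_gap N J A0 n \<alpha>)" (is "_ \<le> ?bound")
    and "k \<noteq> n \<Longrightarrow> fst (result (update_mode inv_cost N I J obs X G lam n (A, Pres))) k = A k"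
proof -
  let ?row = "update_row inv_cost N J obs X G lam Pres n"
  let ?slice = "\<lambda>i. \<Sum>\<alpha>\<leftarrow>slice obs n i. 1 + J * (4 * J + 7) + 5 * J ^ N + 2 * tuple_gap N J A0 n \<alpha>"
  \<comment> \<open>Replaced rows are left free: row i needs only itself and the later modes to be
    initial.\<close>
  let ?P = "\<lambda>m A'. (\<forall>k. k \<noteq> n \<longrightarrow> A' k = A k) \<and> (\<forall>i\<ge>m. A' n i = A n i)"
  have step: "steps (?row i A') \<le> J * (5 * J + 10) + inv_cost J + ?slice i \<and> ?P (Suc i) (result (?row i A'))"
    if "?P i A'" for i A'
  proof (intro conjI allI impI)
    show "steps (?row i A') \<le> J * (5 * J + 10) + inv_cost J + ?slice i"
      using that n A by (intro steps_update_row) auto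
    show "result (?row i A') k = A k" if "k \<noteq> n" for k
      using that \<open>?P i A'\<close> by (auto simp: update_row_changes_only)
    show "result (?row i A') n i' = A n i'" if "Suc i \<le> i'" for i'
      using that \<open>?P i A'\<close> by (simp add: update_row_changes_only)
  qed
  define A' where "A' = result (for_each [0..<I] ?row A)"
  have "steps (for_each [0..<I] ?row A) \<le> (\<Sum>i = 0..<I. Suc (J * (5 * J + 10) + inv_cost J + ?slice i)) \<and> ?P I A'"
    unfolding A'_def by (rule for_each_upt_invariant) (use step in auto)
  then have rows: "steps (for_each [0..<I] ?row A) \<le> (\<Sum>i<I. Suc (J * (5 * J + 10) + inv_cost J + ?slice i))"
    and A': "\<And>k. k \<noteq> n \<Longrightarrow> A' k = A k"
    by (simp_all add: atLeast0LessThan)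
  have "(\<Sum>i<I. Suc (J * (5 * J + 10) + inv_cost J + ?slice i))
      = I * (1 + J * (5 * J + 10) + inv_cost J) + (\<Sum>i<I. ?slice i)"
    by (simp only: add_Suc[symmetric] sum.distrib) (simp add: distrib_left)
  also have "(\<Sum>i<I. ?slice i) = length obs * (1 + J * (4 * J + 7) + 5 * J ^ N) + 2 * (\<Sum>\<alpha>\<leftarrow>obs. tuple_gap N J A0 n \<alpha>)"
    using obs by (subst sum_slices) (simp_all only: sum_list_affine)
  finally have rows': "steps (for_each [0..<I] ?row A)
      \<le> I * (1 + J * (5 * J + 10) + inv_cost J)
        + (length obs * (1 + J * (4 * J + 7) + 5 * J ^ N) + 2 * (\<Sum>\<alpha>\<leftarrow>obs. tuple_gap N J A0 n \<alpha>))"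
    using rows by simp
  have copy: "steps (copy_matrix I J (A n)) \<le> I * (2 * J + 1)"
    unfolding copy_matrix_def by (rule steps_fill_matrix)
  have cache: "steps (update_cache N J obs G (result (copy_matrix I J (A n))) A' n Pres)
      \<le> (\<Sum>\<alpha>\<leftarrow>obs. 1 + 5 * J ^ N + 2 * tuple_gap N J A0 n \<alpha>)"
    using n A A' obs by (intro steps_update_cache) (simp_all add: result_copy_matrix)
  also have "\<dots> = length obs * (1 + 5 * J ^ N) + 2 * (\<Sum>\<alpha>\<leftarrow>obs. tuple_gap N J A0 n \<alpha>)"
    by (rule sum_list_affine)
  finally show "steps (update_mode inv_cost N I J obs X G lam n (A, Pres)) \<le> ?bound"
    using rows' copy by (simp add: update_mode_def A'_def algebra_simps power2_eq_square)
  show "k \<noteq> n \<Longrightarrow> fst (result (update_mode inv_cost N I J obs X G lam n (A, Pres))) k = A k"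
    using A' by (simp add: update_mode_def A'_def)
qed

text \<open>The 18 is the 10 of \<open>update_mode_bound\<close> plus 4 * 2 from the total gap.
  Precomputation and error give the term with N + 1, the mode loop passes give N, and the square
  root gives 1.\<close>

lemma steps_iteration:
  assumes obs: "\<And>\<alpha> n. \<alpha> \<in> set obs \<Longrightarrow> n < N \<Longrightarrow> \<alpha> ! n < I"
  shows "steps (ptucker_cache_iteration inv_cost N I J obs X G lam A)
    \<le> N * I * (5 * J ^ 2 + 12 * J + 2 + inv_cost J)
      + N * length obs * (4 * J ^ 2 + 7 * J + 2 + 18 * J ^ N)
      + N + 4 * length obs * J ^ N * (N + 1) + 5 * length obs + 1"
proof -
  let ?mode = "update_mode inv_cost N I J obs X G lam"
  let ?c = "I * (5 * J ^ 2 + 12 * J + 2 + inv_cost J) + length obs * (4 * J ^ 2 + 7 * J + 2 + 10 * J ^ N)"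
  let ?gap = "\<lambda>n. \<Sum>\<alpha>\<leftarrow>obs. tuple_gap N J A n \<alpha>"
  define Pres where "Pres = result (precompute N J obs G A)"
  have step: "steps (?mode n S) \<le> ?c + 4 * ?gap n \<and> (\<forall>k\<ge>Suc n. fst (result (?mode n S)) k = A k)"
    if "n < N" "\<forall>k\<ge>n. fst S k = A k" for n S
    using update_mode_bound[where A = "fst S" and Pres = "snd S" and ?A0.0 = A, of n N obs I] that obs
    by simp
  \<comment> \<open>Invariant: the modes not yet processed still agree with the input
    \<open>A\<close>.\<close>
  have "steps (for_each [0..<N] ?mode (A, Pres)) \<le> (\<Sum>n = 0..<N. Suc (?c + 4 * ?gap n))
      \<and> (\<forall>k\<ge>N. fst (result (for_each [0..<N] ?mode (A, Pres))) k = A k)"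
    by (rule for_each_upt_invariant) (use step in auto)
  then have "steps (for_each [0..<N] ?mode (A, Pres)) \<le> (\<Sum>n<N. Suc (?c + 4 * ?gap n))"
    by (simp add: atLeast0LessThan)
  also have "\<dots> = N * (1 + ?c) + 4 * (\<Sum>n<N. ?gap n)"
    by (simp only: add_Suc[symmetric] sum.distrib sum_distrib_left[symmetric]) (simp add: algebra_simps)
  \<comment> \<open>The exchange is decisive: a single gap can be of order N, but for fixed \<alpha>
    and \<beta> the gaps of all modes together are at most 2N.\<close>
  also have "(\<Sum>n<N. ?gap n) = (\<Sum>\<alpha>\<leftarrow>obs. \<Sum>n<N. tuple_gap N J A n \<alpha>)"
    by (rule sum_sum_list_swap)
  also have "\<dots> \<le> (\<Sum>\<alpha>\<leftarrow>obs. 2 * N * J ^ N)"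
    by (intro sum_list_mono sum_tuple_gap)
  also have "\<dots> = length obs * (2 * N * J ^ N)"
    by (simp add: sum_list_triv)
  finally have modes: "steps (for_each [0..<N] ?mode (A, Pres)) \<le> N * (1 + ?c) + 4 * (length obs * (2 * N * J ^ N))"
    by simp
  show ?thesis
    using modes steps_precompute[of N J obs G A]
      steps_reconstruction_error[of N J obs X G "fst (result (for_each [0..<N] ?mode (A, Pres)))"]
    by (simp add: ptucker_cache_iteration_def case_prod_beta Pres_def algebra_simps)
qed

section \<open>Absorbing the lower-order terms\<close>

text \<open>The asymptotic bound holds only from some \<open>J0\<close> on. The finitely many
  smaller values are added to the constant, which suffices because J \<ge> 1 gives J^3 \<ge>
  1.\<close>

lemma bigo_cube_bound:
  fixes f :: "nat \<Rightarrow> nat"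
  assumes "(\<lambda>J. real (f J)) \<in> O(\<lambda>J. real J ^ 3)"
  obtains c :: nat where "\<And>J. 1 \<le> J \<Longrightarrow> f J \<le> c * J ^ 3"
proof -
  obtain C where "\<forall>\<^sub>F J in at_top. norm (real (f J)) \<le> C * norm (real J ^ 3)"
    using assms by (elim landau_o.bigE)
  then obtain J0 where J0: "\<And>J. J0 \<le> J \<Longrightarrow> real (f J) \<le> C * real J ^ 3"
    by (auto simp: eventually_at_top_linorder)
  have "f J \<le> (nat \<lceil>C\<rceil> + (\<Sum>j<J0. f j)) * J ^ 3" if "1 \<le> J" for J
  proof (cases "J < J0")
    case True
    then have "f J \<le> (\<Sum>j<J0. f j)" by (intro member_le_sum) auto
    also have "\<dots> \<le> (\<Sum>j<J0. f j) * J ^ 3" using that by simp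
    finally show ?thesis by (simp add: add_mult_distrib)
  next
    case False
    then have "real (f J) \<le> C * real J ^ 3" using J0 by simp
    also have "\<dots> \<le> real (nat \<lceil>C\<rceil>) * real J ^ 3"
      by (intro mult_right_mono) (auto simp: real_nat_ceiling_ge)
    finally have "f J \<le> nat \<lceil>C\<rceil> * J ^ 3"
      by (metis of_nat_le_iff of_nat_mult of_nat_power)
    then show ?thesis by (simp add: add_mult_distrib)
  qed
  then show thesis by (rule that)
qed

lemma card_index_tuples: "finite (index_tuples N d)" "card (index_tuples N d) = d ^ N"
  using finite_lists_length_eq[of "{..<d}" N] card_lists_length_eq[of "{..<d}" N]
  by (simp_all add: index_tuples_def conj_commute)

lemma outer_product_cost:
  assumes "\<Omega> \<subseteq> index_tuples N I" "1 \<le> N" "1 \<le> J"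
  shows "card \<Omega> * J ^ 2 \<le> I * J ^ 3 + card \<Omega> * J ^ N"
proof (cases "N = 1")
  case True
  then have "card \<Omega> \<le> I"
    using card_mono[OF card_index_tuples(1) assms(1)] by (simp add: card_index_tuples)
  then have "card \<Omega> * J ^ 2 \<le> I * J ^ 3"
    using assms by (intro mult_mono power_increasing) auto
  then show ?thesis by simp
next
  case False
  then have "J ^ 2 \<le> J ^ N"
    using assms by (intro power_increasing) auto
  then show ?thesis by (simp add: trans_le_add2)
qed

theorem theorem5:
  fixes inv_cost :: "nat \<Rightarrow> nat"
  assumes "(\<lambda>J. real (inv_cost J)) \<in> O(\<lambda>J. real J ^ 3)"
  shows "\<exists>C::real. \<forall>(N::nat) (I::nat) (J::nat) (\<Omega>::nat list set) (obs::nat list list)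
           (X::tensor) (G::tensor) (lam::real) (A::factors).
           1 \<le> N \<longrightarrow> 1 \<le> I \<longrightarrow> 1 \<le> J \<longrightarrow> lam > 0 \<longrightarrow>
           \<Omega> \<subseteq> index_tuples N I \<longrightarrow> distinct obs \<longrightarrow> set obs = \<Omega> \<longrightarrow>
           real (steps (ptucker_cache_iteration inv_cost N I J obs X G lam A))
             \<le> C * (real N * real I * real J ^ 3 + real N * real (card \<Omega>) * real J ^ N)"
proof -
  obtain c where c: "\<And>J. 1 \<le> J \<Longrightarrow> inv_cost J \<le> c * J ^ 3"
    using bigo_cube_bound[OF assms] by blast
  \<comment> \<open>The bounds below need c + 19 + 4 + 2 copies of \<open>?M\<close> and 31 + 8 + 5
    copies of \<open>?W\<close>; c + 60 exceeds both.\<close>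
  have main: "steps (ptucker_cache_iteration inv_cost N I J obs X G lam A)
      \<le> (c + 60) * (N * I * J ^ 3 + N * card \<Omega> * J ^ N)"
    if N: "1 \<le> N" and I: "1 \<le> I" and J: "1 \<le> J" and \<Omega>: "\<Omega> \<subseteq> index_tuples N I"
      and obs: "distinct obs" "set obs = \<Omega>"
    for N I J \<Omega> obs X G lam and A :: factors
  proof -
    let ?M = "N * I * J ^ 3" and ?W = "N * card \<Omega> * J ^ N"
    have len: "length obs = card \<Omega>"
      using obs distinct_card by metis
    have coord: "\<alpha> ! n < I" if "\<alpha> \<in> set obs" "n < N" for \<alpha> n
    proof -
      have "\<alpha> \<in> index_tuples N I" using that obs \<Omega> by auto
      then show ?thesis using that nth_mem[of n \<alpha>] by (force simp: index_tuples_def)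
    qed
    have "J \<le> J ^ 3" "J ^ 2 \<le> J ^ 3" "1 \<le> J ^ 3" "J \<le> J ^ N" "1 \<le> J ^ N"
      using J N power_increasing[of 1 3 J] power_increasing[of 2 3 J] power_increasing[of 1 N J]
      by simp_all
    note powers = this
    have rows: "N * I * (5 * J ^ 2 + 12 * J + 2 + inv_cost J) \<le> (c + 19) * ?M"
    proof -
      have "5 * J ^ 2 + 12 * J + 2 + inv_cost J \<le> (c + 19) * J ^ 3"
        using powers(1-3) c[OF J] by (simp add: add_mult_distrib)
      then have "N * I * (5 * J ^ 2 + 12 * J + 2 + inv_cost J) \<le> N * I * ((c + 19) * J ^ 3)"
        by (rule mult_le_mono2)
      then show ?thesis by (simp add: mult_ac)
    qed
    have entries: "N * card \<Omega> * (4 * J ^ 2 + 7 * J + 2 + 18 * J ^ N) \<le> 4 * ?M + 31 * ?W"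
    proof -
      \<comment> \<open>Only the quadratic term needs the share of \<open>?M\<close>; the others are
        at most 7 + 2 + 18 = 27 times J^N.\<close>
      have "N * (card \<Omega> * J ^ 2) \<le> N * (I * J ^ 3 + card \<Omega> * J ^ N)"
        by (intro mult_le_mono2 outer_product_cost[OF \<Omega> N J])
      moreover have "N * card \<Omega> * (7 * J + 2 + 18 * J ^ N) \<le> N * card \<Omega> * (27 * J ^ N)"
        using powers(4,5) by (intro mult_le_mono2) simp
      ultimately show ?thesis by (simp add: algebra_simps)
    qed
    \<comment> \<open>The N + 1 operations independent of \<Omega> must go into \<open>?M\<close>,
      since \<open>?W\<close> vanishes for empty \<Omega>.\<close>
    have "N * (1 * 1) \<le> N * (I * J ^ 3)"
      using I powers(3) by (intro mult_le_mono) auto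
    then have modes: "N + 1 \<le> 2 * ?M" using N unfolding mult.assoc by linarith
    have "card \<Omega> * J ^ N * (N + 1) \<le> card \<Omega> * J ^ N * (2 * N)"
      using N by (intro mult_le_mono2) simp
    then have products: "4 * card \<Omega> * J ^ N * (N + 1) \<le> 8 * ?W"
      by (simp add: algebra_simps)
    \<comment> \<open>This absorbs the term \<open>5 * length obs\<close>.\<close>
    have "1 * card \<Omega> * 1 \<le> ?W"
      using N powers(5) by (intro mult_le_mono) auto
    then show ?thesis
      using steps_iteration[of obs N I inv_cost J X G lam A, OF coord] rows entries modes products
      unfolding len add_mult_distrib distrib_left by linarith
  qed
  show ?thesis
  proof (intro exI allI impI)
    fix N I J :: nat and \<Omega> obs X G and lam :: real and A :: factors
    assume "1 \<le> N" "1 \<le> I" "1 \<le> J" "\<Omega> \<subseteq> index_tuples N I" "distinct obs" "set obs = \<Omega>"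
    from main[OF this, of X G lam A]
    have "real (steps (ptucker_cache_iteration inv_cost N I J obs X G lam A))
        \<le> real ((c + 60) * (N * I * J ^ 3 + N * card \<Omega> * J ^ N))"
      by (rule of_nat_mono)
    then show "real (steps (ptucker_cache_iteration inv_cost N I J obs X G lam A))
        \<le> real (c + 60) * (real N * real I * real J ^ 3 + real N * real (card \<Omega>) * real J ^ N)"
      by simp
  qed
qed

end
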